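(* Let $T$ be a tree on at least two vertices, and let $R\subseteq V(T)$ be either a set $\{r\}$ such that $r$ is not a leaf of $T$, or a set $\{p,q\}$ such that $\{p,q\}\in E(T)$. Then there is a weight assignment $\mathbf{w}$ on $T$ such that the characteristic set of the weighted tree $(T,\mathbf{w})$ is $R$.
   Context: A weight assignment on a graph $G$ is an entrywise positive vector $\mathbf{w}\in\mathbb{R}^{E(G)}$; write $\mathbf{w}(i,j)$ for the weight of the edge $\{i,j\}$. The weighted Laplacian matrix of $(G,\mathbf{w})$ is the symmetric matrix indexed by $V(G)$ whose off-diagonal $i,j$-entry is $-\mathbf{w}(i,j)$ if $\{i,j\}\in E(G)$ and $0$ otherwise, and whose row sums are all zero. A Fiedler vector of $(G,\mathbf{w})$ is an eigenvector of this matrix with respect to its second smallest eigenvalue. Characteristic set of a weighted tree $(T,\mathbf{w})$: if $\mathbf{x}=(x_i)$ is a Fiedler vector of $(T,\mathbf{w})$, it is known that exactly one of two cases occurs. Type I: some entry of $\mathbf{x}$ is zero; then there is exactly one vertex $i$ with $x_i=0$ that is adjacent to some vertex $j$ with $x_j\ne 0$, and the characteristic set is $\{i\}$. Type II: no entry of $\mathbf{x}$ is zero; then there is exactly one edge $\{i,j\}$ with $x_ix_j<0$, and the characteristic set is $\{i,j\}$. It is known that the characteristic set does not depend on the choice of the Fiedler vector $\mathbf{x}$ of $(T,\mathbf{w})$. *)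

theory Defs
  imports
    "HOL-Analysis.Analysis"
    "HOL-Computational_Algebra.Polynomial_Factorial"
    "HOL-Library.Multiset"
begin

text \<open>
  A graph has as its vertex set all of the finite type \<open>'n\<close> and is given by its set of edges,
  each edge being a two-element set of vertices. Weights are functions on sets of vertices; only
  their values on edges matter.
\<close>

definition simple_graph :: "'n::finite set set \<Rightarrow> bool" where
  "simple_graph E \<longleftrightarrow> (\<forall>e\<in>E. card e = 2)"

definition connected_graph :: "'n::finite set set \<Rightarrow> bool" where
  "connected_graph E \<longleftrightarrow> (\<forall>u v. (u, v) \<in> {(i, j). {i, j} \<in> E}\<^sup>*)"

definition graph_cycle :: "'n::finite set set \<Rightarrow> 'n list \<Rightarrow> bool" where
  "graph_cycle E vs \<longleftrightarrow> 3 \<le> length vs \<and> distinct vs \<and>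
     (\<forall>i<length vs. {vs ! i, vs ! (Suc i mod length vs)} \<in> E)"

definition tree :: "'n::finite set set \<Rightarrow> bool" where
  "tree E \<longleftrightarrow> simple_graph E \<and> connected_graph E \<and> (\<nexists>vs. graph_cycle E vs)"

definition leaf :: "'n::finite set set \<Rightarrow> 'n \<Rightarrow> bool" where
  "leaf E v \<longleftrightarrow> card {e \<in> E. v \<in> e} = 1"

definition weight_assignment :: "'n::finite set set \<Rightarrow> ('n set \<Rightarrow> real) \<Rightarrow> bool" where
  "weight_assignment E w \<longleftrightarrow> (\<forall>e\<in>E. 0 < w e)"

definition weighted_laplacian :: "'n::finite set set \<Rightarrow> ('n set \<Rightarrow> real) \<Rightarrow> real ^ 'n ^ 'n" where
  "weighted_laplacian E w =
     (\<chi> i j. if i = j then \<Sum>k | k \<noteq> i \<and> {i, k} \<in> E. w {i, k}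
            else if {i, j} \<in> E then - w {i, j} else 0)"

lemma weighted_laplacian_row_sum:
  "(\<Sum>j\<in>UNIV. weighted_laplacian E w $ i $ j) = 0"
proof -
  have "(\<Sum>j\<in>UNIV - {i}. weighted_laplacian E w $ i $ j) =
        (\<Sum>j\<in>UNIV - {i}. if {i, j} \<in> E then - w {i, j} else 0)"
    by (rule sum.cong) (auto simp: weighted_laplacian_def)
  also have "\<dots> = (\<Sum>k | k \<noteq> i \<and> {i, k} \<in> E. - w {i, k})"
    by (rule sum.mono_neutral_cong_right) auto
  also have "\<dots> = - weighted_laplacian E w $ i $ i"
    by (simp add: weighted_laplacian_def sum_negf)
  finally show ?thesis
    by (simp add: sum.remove[of UNIV i])
qed

definition charpoly :: "real ^ 'n ^ 'n \<Rightarrow> real poly" where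
  "charpoly A = det (mat [:0, 1:] - (\<chi> i j. [:A $ i $ j:]))"

text \<open>
  The eigenvalues are listed in nondecreasing order and with multiplicity. The multiset of real
  roots of the characteristic polynomial is the whole spectrum when the matrix is symmetric.
\<close>

definition second_smallest_eigenvalue :: "real ^ 'n ^ 'n \<Rightarrow> real" where
  "second_smallest_eigenvalue A = sorted_list_of_multiset (proots (charpoly A)) ! 1"

definition eigenvector :: "real ^ 'n ^ 'n \<Rightarrow> real \<Rightarrow> real ^ 'n \<Rightarrow> bool" where
  "eigenvector A l x \<longleftrightarrow> x \<noteq> 0 \<and> A *v x = l *\<^sub>R x"

definition fiedler_vector :: "'n::finite set set \<Rightarrow> ('n set \<Rightarrow> real) \<Rightarrow> real ^ 'n \<Rightarrow> bool" where
  "fiedler_vector E w x \<longleftrightarrow>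
     (let L = weighted_laplacian E w in eigenvector L (second_smallest_eigenvalue L) x)"

text \<open>
  The set read off from one vector: in the first branch (Type I) exactly one vertex has the required
  property, in the second (Type II) exactly one edge does.
\<close>

definition characteristic_set_of_vector :: "'n::finite set set \<Rightarrow> real ^ 'n \<Rightarrow> 'n set \<Rightarrow> bool" where
  "characteristic_set_of_vector E x C \<longleftrightarrow>
     (if \<exists>v. x $ v = 0
      then \<exists>i. {k. x $ k = 0 \<and> (\<exists>j. {k, j} \<in> E \<and> x $ j \<noteq> 0)} = {i} \<and> C = {i}
      else \<exists>i j. {e \<in> E. \<exists>k l. e = {k, l} \<and> x $ k * x $ l < 0} = {{i, j}} \<and> C = {i, j})"

text \<open>
  The characteristic set of a weighted tree does not depend on the Fiedler vector, so every Fiedler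
  vector has to yield it; the existence clause excludes the vacuous case.
\<close>

definition characteristic_set :: "'n::finite set set \<Rightarrow> ('n set \<Rightarrow> real) \<Rightarrow> 'n set \<Rightarrow> bool" where
  "characteristic_set E w C \<longleftrightarrow>
     (\<exists>x. fiedler_vector E w x) \<and>
     (\<forall>x. fiedler_vector E w x \<longrightarrow> characteristic_set_of_vector E x C)"

end

theory Submission
  imports Defs
begin

text \<open>
  The weights are found by prescribing the eigenvector first. On a tree, removing an edge \<open>{v, u}\<close>
  leaves two sides; if \<open>x\<close> is a vector with entry sum zero, then \<open>L x = x\<close> holds as soon as every edge
  carries the flow \<open>w {v, u} * (x v - x u) = \<close> sum of \<open>x\<close> over the side of \<open>v\<close>. This equation
  determines the weights, and they are positive precisely when every sum over a side has the sign of
  the corresponding difference of \<open>x\<close> (\<open>tree_weights_for_eigenvector\<close>). That is the case when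
  \<open>x\<close> is negative on one branch \<open>B\<close> at a vertex \<open>r\<close>, positive on the other branches, nonnegative
  at \<open>r\<close>, and grows in absolute value with the distance from \<open>r\<close> on each of these two parts
  (\<open>tree_eigenvector_with_sign_change\<close>). With \<open>x r = 0\<close> the sign changes
  at the vertex \<open>r\<close>; with \<open>x r = 1\<close> it changes along the edge from \<open>r\<close> into \<open>B\<close>.

  It remains to see that the eigenvalue 1 is the second smallest one and to determine its whole
  eigenspace. Let \<open>y\<close> be an eigenvector for an eigenvalue \<open>m \<noteq> 0\<close>, so that its entries sum to zero.
  Subtract a constant \<open>c\<close> from \<open>y\<close> such that the difference \<open>z = f x\<close> vanishes where \<open>x\<close> changes
  sign: at the vertex \<open>r\<close>, or at the point inside the edge where the linear interpolation of \<open>x\<close> is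
  zero. Writing the quadratic form of \<open>L\<close> in terms of \<open>f\<close> (\<open>ground_state_identity\<close>) gives
  \<open>m |y|\<^sup>2 = z \<bullet> L z \<ge> |z|\<^sup>2 \<ge> |y|\<^sup>2\<close>, hence \<open>m \<ge> 1\<close>. If \<open>m = 1\<close>, equality forces \<open>c = 0\<close> and
  \<open>f\<close> constant along every edge at whose ends \<open>x\<close> is nonzero (\<open>spectral_gap\<close>). So a Fiedler vector is
  \<open>x\<close> rescaled separately on the branches at \<open>r\<close>, or a multiple of \<open>x\<close>, and its
  characteristic set is visible from the signs of \<open>x\<close>.

  Since the second smallest eigenvalue is read off from the roots of the characteristic polynomial
  with multiplicity, 0 also has to be a simple root (\<open>charpoly_zero_simple_root\<close>).
\<close>

section \<open>Branches of a tree at a vertex\<close>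

definition edges_avoiding :: "'n::finite set set \<Rightarrow> 'n \<Rightarrow> ('n \<times> 'n) set" where
  "edges_avoiding E v = {(i, j). {i, j} \<in> E \<and> i \<noteq> v \<and> j \<noteq> v}"

text \<open>
  For \<open>u \<noteq> v\<close> this is the component of \<open>u\<close> after deleting the vertex \<open>v\<close>. For an edge \<open>{u, v}\<close> of a
  tree it is also the side of \<open>u\<close> after deleting the edge, which is how it is mostly used. The start
  vertex always belongs to it, so that \<open>branch E v v = {v}\<close>.
\<close>

definition branch :: "'n::finite set set \<Rightarrow> 'n \<Rightarrow> 'n \<Rightarrow> 'n set" where
  "branch E v u = {y. (u, y) \<in> (edges_avoiding E v)\<^sup>*}"

text \<open>
  Acyclicity speaks of lists of distinct vertices, whereas connectedness is a reflexive transitive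
  closure; cutting out loops translates between the two.
\<close>

lemma rtrancl_distinct_path:
  assumes "(a, b) \<in> r\<^sup>*"
  obtains vs where "vs \<noteq> []" "hd vs = a" "last vs = b" "distinct vs"
    "successively (\<lambda>i j. (i, j) \<in> r) vs"
proof -
  have "\<exists>vs. vs \<noteq> [] \<and> hd vs = a \<and> last vs = b \<and> distinct vs \<and> successively (\<lambda>i j. (i, j) \<in> r) vs"
    using assms
  proof (induction rule: converse_rtrancl_induct)
    case base
    show ?case by (rule exI[of _ "[b]"]) auto
  next
    case (step y z)
    then obtain vs where vs: "vs \<noteq> []" "hd vs = z" "last vs = b" "distinct vs"
      "successively (\<lambda>i j. (i, j) \<in> r) vs" by blast
    show ?case
    proof (cases "y \<in> set vs")
      case True
      then obtain as bs where "vs = as @ y # bs" by (meson split_list)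
      with vs show ?thesis
        by (intro exI[of _ "y # bs"]) (auto simp: successively_append_iff)
    next
      case False
      with vs step show ?thesis
        by (intro exI[of _ "y # vs"]) (auto simp: successively_Cons)
    qed
  qed
  with that show ?thesis by blast
qed

lemma sym_edges_avoiding: "sym (edges_avoiding E v)"
  by (auto simp: sym_def edges_avoiding_def insert_commute)

lemma branch_refl: "u \<in> branch E v u"
  by (simp add: branch_def)

lemma branch_eq:
  assumes "y \<in> branch E v u"
  shows "branch E v y = branch E v u"
  using assms sym_rtrancl[OF sym_edges_avoiding, of E v]
  unfolding branch_def by (auto dest: symD intro: rtrancl_trans)

lemma branch_step:
  assumes "y \<in> branch E v u" "{y, z} \<in> E" "y \<noteq> v" "z \<noteq> v"
  shows "z \<in> branch E v u"
  using assms unfolding branch_def edges_avoiding_def by (auto intro: rtrancl_into_rtrancl)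

lemma branch_induct [consumes 1, case_names refl step]:
  assumes "y \<in> branch E v u" "P u"
    "\<And>y z. y \<in> branch E v u \<Longrightarrow> P y \<Longrightarrow> {y, z} \<in> E \<Longrightarrow> y \<noteq> v \<Longrightarrow> z \<noteq> v \<Longrightarrow> P z"
  shows "P y"
proof -
  have "(u, y) \<in> (edges_avoiding E v)\<^sup>*" using assms(1) by (simp add: branch_def)
  then show ?thesis
    by (induction rule: rtrancl_induct) (auto simp: assms edges_avoiding_def branch_def)
qed

lemma centre_notin_branch:
  assumes "u \<noteq> v"
  shows "v \<notin> branch E v u"
proof -
  have "y \<noteq> v" if "y \<in> branch E v u" for y
    using that by (induction rule: branch_induct) (use assms in auto)
  then show ?thesis by blast
qed

lemma tree_edge_neq: "tree E \<Longrightarrow> {i, j} \<in> E \<Longrightarrow> i \<noteq> j"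
  by (auto simp: tree_def simple_graph_def)

lemma tree_induct [consumes 1, case_names start step]:
  assumes "tree E" "P u" "\<And>y z. P y \<Longrightarrow> {y, z} \<in> E \<Longrightarrow> P z"
  shows "P y"
proof -
  have "(u, y) \<in> {(i, j). {i, j} \<in> E}\<^sup>*" using assms(1) by (simp add: tree_def connected_graph_def)
  then show ?thesis by (induction rule: rtrancl_induct) (auto intro: assms(2,3))
qed

text \<open>
  This is the only place where acyclicity enters: a simple path from \<open>a\<close> to \<open>b\<close> that avoids their common
  neighbour \<open>v\<close> would close up through \<open>v\<close> to a cycle.
\<close>

lemma tree_neighbours_in_distinct_branches:
  assumes T: "tree E" and "{v, a} \<in> E" "{v, b} \<in> E" "b \<in> branch E v a"
  shows "a = b"
proof (rule ccontr)
  assume "a \<noteq> b"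
  have "a \<noteq> v" using T assms(2) tree_edge_neq by blast
  from assms(4) obtain vs where vs: "vs \<noteq> []" "hd vs = a" "last vs = b" "distinct vs"
    "successively (\<lambda>i j. (i, j) \<in> edges_avoiding E v) vs"
    unfolding branch_def by (auto elim: rtrancl_distinct_path)
  have len: "length vs \<ge> 2"
    using vs(1-3) \<open>a \<noteq> b\<close> by (cases vs; cases "tl vs") auto
  have step: "(vs ! i, vs ! Suc i) \<in> edges_avoiding E v" if "Suc i < length vs" for i
    using vs(5) that by (simp add: successively_conv_nth)
  have "vs ! i \<noteq> v" if "i < length vs" for i
  proof (cases i)
    case 0
    then show ?thesis using vs(1,2) \<open>a \<noteq> v\<close> by (simp add: hd_conv_nth)
  next
    case (Suc k)
    then show ?thesis using step[of k] that by (auto simp: edges_avoiding_def)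
  qed
  then have "v \<notin> set vs" by (auto simp: in_set_conv_nth)
  have "{(v # vs) ! i, (v # vs) ! (Suc i mod length (v # vs))} \<in> E" if "i < length (v # vs)" for i
  proof (cases "i = length vs")
    case True
    then have "(v # vs) ! i = b" using vs(1,3) by (cases i) (auto simp: last_conv_nth)
    with True assms(3) show ?thesis by (simp add: insert_commute)
  next
    case False
    with that have i: "i < length vs" by simp
    show ?thesis
    proof (cases i)
      case 0
      with vs(1,2) assms(2) i show ?thesis by (simp add: hd_conv_nth)
    next
      case (Suc k)
      with step[of k] i show ?thesis by (auto simp: edges_avoiding_def)
    qed
  qed
  with vs(4) \<open>v \<notin> set vs\<close> len have "graph_cycle E (v # vs)"
    unfolding graph_cycle_def by auto
  with T show False by (auto simp: tree_def)
qed

lemma tree_in_some_branch: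
  assumes T: "tree E" and "y \<noteq> v"
  obtains u where "{v, u} \<in> E" "y \<in> branch E v u"
proof -
  have "y = v \<or> (\<exists>u. {v, u} \<in> E \<and> y \<in> branch E v u)"
    using T
  proof (induction y rule: tree_induct[where u = v])
    case (step y z)
    consider "z = v" | "y = v" | "y \<noteq> v" "z \<noteq> v" by blast
    then show ?case
    proof cases
      case 2
      with step(2) show ?thesis using branch_refl[of z E v] by auto
    next
      case 3
      with step(1) obtain u where u: "{v, u} \<in> E" "y \<in> branch E v u" by blast
      from branch_step[OF u(2) step(2) 3] u(1) show ?thesis by blast
    qed simp
  qed auto
  with assms(2) that show ?thesis by blast
qed

lemma tree_branches_disjoint:
  assumes T: "tree E" and "{v, a} \<in> E" "{v, b} \<in> E" "y \<in> branch E v a" "y \<in> branch E v b"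
  shows "a = b"
  using tree_neighbours_in_distinct_branches[OF T assms(2,3)] branch_eq[OF assms(4)]
    branch_eq[OF assms(5)] branch_refl by metis

lemma tree_edge_sides_cover:
  assumes T: "tree E" and e: "{u, v} \<in> E"
  shows "y \<in> branch E v u \<or> y \<in> branch E u v"
  using T
proof (induction y rule: tree_induct[where u = u])
  case (step y z)
  then show ?case
    using branch_step[of y E v u z] branch_step[of y E u v z] branch_refl[of u E v]
      branch_refl[of v E u] centre_notin_branch[of u v E] centre_notin_branch[of v u E]
      tree_edge_neq[OF T e] by blast
qed (simp add: branch_refl)

text \<open>
  A vertex other than \<open>v\<close> that is reached from \<open>v\<close> while avoiding \<open>u\<close> lies in the branch at \<open>v\<close> of
  some neighbour different from \<open>u\<close>, and distinct neighbours have disjoint branches.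
\<close>

lemma tree_edge_sides_disjoint:
  assumes T: "tree E" and e: "{u, v} \<in> E" and y: "y \<in> branch E v u"
  shows "y \<notin> branch E u v"
proof
  assume y': "y \<in> branch E u v"
  have uv: "u \<noteq> v" using T e tree_edge_neq by blast
  have "y = v \<or> (\<exists>a. a \<noteq> u \<and> {v, a} \<in> E \<and> y \<in> branch E v a)"
    using y'
  proof (induction rule: branch_induct)
    case (step y z)
    show ?case
    proof (cases "y = v \<or> z = v")
      case True
      with \<open>{y, z} \<in> E\<close> \<open>z \<noteq> u\<close> branch_refl[of z E v] show ?thesis by auto
    next
      case False
      with step.IH obtain a where a: "a \<noteq> u" "{v, a} \<in> E" "y \<in> branch E v a" by blast
      with branch_step[OF a(3) \<open>{y, z} \<in> E\<close>] False show ?thesis by auto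
    qed
  qed auto
  then show False
  proof
    assume "y = v" with y centre_notin_branch uv show False by metis
  next
    assume "\<exists>a. a \<noteq> u \<and> {v, a} \<in> E \<and> y \<in> branch E v a"
    with y e tree_branches_disjoint[OF T] show False by (metis insert_commute)
  qed
qed

lemma sum_over_tree_branches:
  fixes x :: "'n::finite \<Rightarrow> real"
  assumes T: "tree E"
  shows "(\<Sum>u | {v, u} \<in> E. sum x (branch E v u)) = sum x UNIV - x v"
proof -
  have "(\<Sum>u | {v, u} \<in> E. sum x (branch E v u)) = sum x (\<Union>u\<in>{u. {v, u} \<in> E}. branch E v u)"
    using tree_branches_disjoint[OF T]
    by (intro sum.UNION_disjoint[symmetric]) (simp, simp, blast)
  also have "(\<Union>u\<in>{u. {v, u} \<in> E}. branch E v u) = UNIV - {v}"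
  proof (intro equalityI subsetI)
    fix y assume "y \<in> (\<Union>u\<in>{u. {v, u} \<in> E}. branch E v u)"
    then obtain u where u: "{v, u} \<in> E" "y \<in> branch E v u" by blast
    with tree_edge_neq[OF T u(1)] centre_notin_branch[of u v E] show "y \<in> UNIV - {v}" by auto
  next
    fix y assume "y \<in> UNIV - {v}"
    then show "y \<in> (\<Union>u\<in>{u. {v, u} \<in> E}. branch E v u)"
      using tree_in_some_branch[OF T, of y v] by blast
  qed
  finally show ?thesis by (simp add: sum_diff1)
qed

lemma sum_over_edge_sides:
  fixes x :: "'n::finite \<Rightarrow> real"
  assumes T: "tree E" and e: "{u, v} \<in> E"
  shows "sum x (branch E v u) + sum x (branch E u v) = sum x UNIV"
proof -
  have "branch E v u \<inter> branch E u v = {}" "branch E v u \<union> branch E u v = UNIV"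
    using tree_edge_sides_disjoint[OF T e] tree_edge_sides_cover[OF T e] by auto
  then show ?thesis using sum.union_disjoint[of "branch E v u" "branch E u v" x] by auto
qed

text \<open>
  A substitute for the distance from the root \<open>r\<close>: the number of vertices that remain connected to
  \<open>r\<close> when \<open>v\<close> is deleted. All that matters is that it is zero at the root and strictly increases along
  edges leading away from it.
\<close>

definition depth :: "'n::finite set set \<Rightarrow> 'n \<Rightarrow> 'n \<Rightarrow> real" where
  "depth E r v = (if v = r then 0 else real (card (branch E v r)))"

lemma depth_pos: "v \<noteq> r \<Longrightarrow> 0 < depth E r v"
  using branch_refl[of r E v] by (auto simp: depth_def card_gt_0_iff)

text \<open>
  Deleting \<open>v\<close> leaves \<open>r\<close> connected to \<open>u\<close> and to everything that stays connected to \<open>r\<close> when \<open>u\<close>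
  is deleted instead.
\<close>

lemma depth_increases:
  assumes T: "tree E" and e: "{v, u} \<in> E" and r: "r \<in> branch E v u"
  shows "depth E r u < depth E r v"
proof -
  have uv: "u \<noteq> v" using T e tree_edge_neq by blast
  have e': "{u, v} \<in> E" using e by (simp add: insert_commute)
  have rv: "v \<noteq> r" using r centre_notin_branch[OF uv] by auto
  show ?thesis
  proof (cases "u = r")
    case True
    with depth_pos[OF rv] show ?thesis by (simp add: depth_def)
  next
    case False
    have nr: "r \<notin> branch E u v" using tree_edge_sides_disjoint[OF T e' r] .
    have "branch E u r \<subseteq> branch E v r - {u}"
    proof
      fix y assume y: "y \<in> branch E u r"
      have "y \<notin> branch E u v"
        using nr branch_eq[OF y] branch_eq[of y E u v] branch_refl by metis
      with tree_edge_sides_cover[OF T e', of y] branch_eq[OF r] have "y \<in> branch E v r" by simp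
      moreover have "y \<noteq> u" using y False centre_notin_branch[of r u E] by auto
      ultimately show "y \<in> branch E v r - {u}" by simp
    qed
    moreover have "u \<in> branch E v r" using branch_eq[OF r] branch_refl[of u E v] by simp
    ultimately have "branch E u r \<subset> branch E v r" by auto
    then have "card (branch E u r) < card (branch E v r)"
      by (intro psubset_card_mono) auto
    with False rv show ?thesis by (simp add: depth_def)
  qed
qed

text \<open>
  If \<open>r\<close> lies beyond \<open>u\<close>, the subtree hanging at \<open>v\<close> does not meet \<open>r\<close>, so its paths also avoid \<open>r\<close>.
  Hence each such subtree is contained in a single branch at \<open>r\<close>, on which the prescribed vector will
  have constant sign.
\<close>

lemma subtree_subset_branch:
  assumes T: "tree E" and e: "{v, u} \<in> E" and r: "r \<in> branch E v u"
  shows "branch E u v \<subseteq> branch E r v"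
proof
  have e': "{u, v} \<in> E" using e by (simp add: insert_commute)
  have nr: "r \<notin> branch E u v" using tree_edge_sides_disjoint[OF T e' r] .
  fix y assume "y \<in> branch E u v"
  then show "y \<in> branch E r v"
  proof (induction rule: branch_induct)
    case refl show ?case by (rule branch_refl)
  next
    case (step y z)
    moreover from step have "z \<in> branch E u v" by (blast intro: branch_step)
    ultimately show ?case using nr by (metis branch_step)
  qed
qed

section \<open>Weights with a prescribed eigenvector\<close>

definition adj_weight :: "'n::finite set set \<Rightarrow> ('n set \<Rightarrow> real) \<Rightarrow> 'n \<Rightarrow> 'n \<Rightarrow> real" where
  "adj_weight E w i j = (if {i, j} \<in> E then w {i, j} else 0)"

lemma adj_weight_commute: "adj_weight E w i j = adj_weight E w j i"
  by (simp add: adj_weight_def insert_commute)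

lemma adj_weight_nonneg: "weight_assignment E w \<Longrightarrow> 0 \<le> adj_weight E w i j"
  by (auto simp: adj_weight_def weight_assignment_def intro: less_imp_le)

lemma adj_weight_pos: "weight_assignment E w \<Longrightarrow> {i, j} \<in> E \<Longrightarrow> 0 < adj_weight E w i j"
  by (auto simp: adj_weight_def weight_assignment_def)

lemma weighted_laplacian_apply:
  "(weighted_laplacian E w *v y) $ i = (\<Sum>j\<in>UNIV. adj_weight E w i j * (y $ i - y $ j))"
proof -
  have *: "weighted_laplacian E w $ i $ j = - adj_weight E w i j" if "j \<noteq> i" for j
    using that by (auto simp: weighted_laplacian_def adj_weight_def)
  have "(weighted_laplacian E w *v y) $ i = (\<Sum>j\<in>UNIV. weighted_laplacian E w $ i $ j * y $ j)"
    by (simp add: matrix_vector_mult_def)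
  also have "\<dots> = (\<Sum>j\<in>UNIV. weighted_laplacian E w $ i $ j * y $ j)
      - y $ i * (\<Sum>j\<in>UNIV. weighted_laplacian E w $ i $ j)"
    by (simp add: weighted_laplacian_row_sum)
  also have "\<dots> = (\<Sum>j\<in>UNIV. weighted_laplacian E w $ i $ j * (y $ j - y $ i))"
    by (simp add: sum_distrib_left algebra_simps sum_subtractf)
  also have "\<dots> = (\<Sum>j\<in>UNIV. adj_weight E w i j * (y $ i - y $ j))"
  proof (rule sum.cong[OF refl])
    fix j show "weighted_laplacian E w $ i $ j * (y $ j - y $ i) = adj_weight E w i j * (y $ i - y $ j)"
      by (cases "j = i") (auto simp: * algebra_simps)
  qed
  finally show ?thesis .
qed

text \<open>
  Weights live on unordered pairs; a symmetric function of the two ends descends to them.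
\<close>

lemma weights_on_pairs:
  assumes "\<And>i j. {i, j} \<in> E \<Longrightarrow> g i j = g j i"
  obtains w :: "'n set \<Rightarrow> real" where "\<And>i j. {i, j} \<in> E \<Longrightarrow> w {i, j} = g i j"
proof
  fix i j assume e: "{i, j} \<in> E"
  let ?P = "\<lambda>t. \<exists>k l. {i, j} = {k, l} \<and> t = g k l"
  have "?P (g i j)" by blast
  then have "?P (Eps ?P)" by (rule someI)
  with e assms show "(\<lambda>e. SOME t. \<exists>k l. e = {k, l} \<and> t = g k l) {i, j} = g i j"
    by (metis (no_types, lifting) doubleton_eq_iff)
qed

text \<open>
  The difference \<open>x v - x u\<close> is turned into a flow through the edge that equals the total of \<open>x\<close> on the
  side of \<open>v\<close>. Because the total of \<open>x\<close> is zero, the two sides of an edge have opposite sums, so the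
  weight does not depend on the orientation. The net flow out of \<open>v\<close> is minus the sum of \<open>x\<close> over
  all branches at \<open>v\<close>, that is, \<open>x v\<close>.
\<close>

lemma tree_weights_for_eigenvector:
  fixes x :: "real ^ 'n::finite"
  assumes T: "tree E" and tot: "(\<Sum>i\<in>UNIV. x $ i) = 0"
    and mono: "\<And>v u. {v, u} \<in> E \<Longrightarrow> 0 < (\<Sum>i\<in>branch E u v. x $ i) / (x $ v - x $ u)"
  obtains w where "weight_assignment E w" "weighted_laplacian E w *v x = x"
proof -
  let ?S = "\<lambda>v u. \<Sum>i\<in>branch E u v. x $ i"
  have anti: "?S v u = - ?S u v" if "{v, u} \<in> E" for u v
    using sum_over_edge_sides[OF T that, of "\<lambda>i. x $ i"] tot by simp
  have "?S v u / (x $ v - x $ u) = ?S u v / (x $ u - x $ v)" if "{v, u} \<in> E" for u v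
    using anti[OF that] by (metis minus_diff_eq minus_divide_divide)
  from weights_on_pairs[of E "\<lambda>v u. ?S v u / (x $ v - x $ u)", OF this]
  obtain w where w: "\<And>v u. {v, u} \<in> E \<Longrightarrow> w {v, u} = ?S v u / (x $ v - x $ u)" by blast
  have pos: "0 < w e" if "e \<in> E" for e
  proof -
    have "card e = 2" using T that by (auto simp: tree_def simple_graph_def)
    then obtain v u where "e = {v, u}" by (auto simp: card_2_iff)
    with w mono that show ?thesis by auto
  qed
  have "(weighted_laplacian E w *v x) $ v = x $ v" for v
  proof -
    have "(weighted_laplacian E w *v x) $ v = (\<Sum>u | {v, u} \<in> E. w {v, u} * (x $ v - x $ u))"
      unfolding weighted_laplacian_apply
      by (rule sum.mono_neutral_cong_right) (auto simp: adj_weight_def)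
    also have "\<dots> = (\<Sum>u | {v, u} \<in> E. - ?S u v)"
    proof (rule sum.cong[OF refl])
      fix u assume "u \<in> {u. {v, u} \<in> E}"
      then have e: "{v, u} \<in> E" by simp
      then have "x $ v - x $ u \<noteq> 0" using mono[OF e] by auto
      then show "w {v, u} * (x $ v - x $ u) = - ?S u v" using w[OF e] anti[OF e] by simp
    qed
    also have "\<dots> = x $ v"
      using sum_over_tree_branches[OF T, of "\<lambda>i. x $ i" v] tot by (simp add: sum_negf)
    finally show ?thesis .
  qed
  then have "weighted_laplacian E w *v x = x" by (simp add: vec_eq_iff)
  with pos that show ?thesis by (auto simp: weight_assignment_def)
qed

text \<open>
  The vector is \<open>depth + s\<close> outside the branch of \<open>b\<close> and \<open>- c * depth\<close> on it, where \<open>c > 0\<close> balances the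
  total. For \<open>s = 0\<close> the root contributes nothing, so there must be a second branch to balance
  against; this is where a vertex that is not a leaf is needed. For \<open>s > 0\<close> the root itself suffices.
\<close>

lemma tree_eigenvector_with_sign_change:
  fixes E :: "'n::finite set set"
  assumes T: "tree E" and e0: "{r, b} \<in> E" and s: "0 \<le> s"
    and nonleaf: "s = 0 \<Longrightarrow> \<exists>a. {r, a} \<in> E \<and> a \<noteq> b"
  shows "\<exists>x w. weight_assignment E w \<and> weighted_laplacian E w *v x = x \<and> x $ r = s \<and>
    (\<forall>i\<in>branch E r b. x $ i < 0) \<and> (\<forall>i\<in>- branch E r b - {r}. 0 < x $ i)"
proof -
  let ?B = "branch E r b"
  have rb: "b \<noteq> r" using T e0 tree_edge_neq by blast
  have rB: "r \<notin> ?B" using centre_notin_branch[OF rb] .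
  define N where "N = (\<Sum>i\<in>?B. depth E r i)"
  define P where "P = (\<Sum>i\<in>-?B. depth E r i + s)"
  have N: "N > 0" unfolding N_def
  proof (rule sum_pos)
    show "0 < depth E r i" if "i \<in> ?B" for i using that rB by (intro depth_pos) auto
  qed (use branch_refl[of b E r] in auto)
  have P: "P > 0"
  proof -
    obtain a where a: "a \<notin> ?B" "depth E r a + s > 0"
    proof (cases "s = 0")
      case True
      then obtain a where "{r, a} \<in> E" "a \<noteq> b" using nonleaf by blast
      then have "a \<notin> ?B" "a \<noteq> r"
        using tree_neighbours_in_distinct_branches[OF T e0] T tree_edge_neq by blast+
      with True depth_pos that show ?thesis by auto
    next
      case False
      with s rB that[of r] show ?thesis by (auto simp: depth_def)
    qed
    show ?thesis unfolding P_def
    proof (rule sum_pos2[of _ a])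
      show "0 \<le> depth E r i + s" for i using s by (auto simp: depth_def)
    qed (use a in auto)
  qed
  define c where "c = P / N"
  have c: "c > 0" using N P by (simp add: c_def)
  define x :: "real ^ 'n" where
    "x = (\<chi> i. if i \<in> ?B then - c * depth E r i else depth E r i + s)"
  have xB: "x $ i = - c * depth E r i" if "i \<in> ?B" for i using that by (simp add: x_def)
  have xnB: "x $ i = depth E r i + s" if "i \<notin> ?B" for i using that by (simp add: x_def)
  have neg: "x $ i < 0" if "i \<in> ?B" for i
  proof -
    have "i \<noteq> r" using that rB by auto
    then show ?thesis using xB[OF that] depth_pos[of i r E] c by simp
  qed
  have pos: "0 < x $ i" if "i \<notin> ?B" "i \<noteq> r" for i
    using xnB[OF that(1)] depth_pos[OF that(2), of E] s by simp
  have xr: "x $ r = s" using xnB[OF rB] by (simp add: depth_def)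
  have tot: "(\<Sum>i\<in>UNIV. x $ i) = 0"
  proof -
    have "(\<Sum>i\<in>UNIV. x $ i) = (\<Sum>i\<in>?B. x $ i) + (\<Sum>i\<in>-?B. x $ i)"
      using sum.union_disjoint[of ?B "-?B" "\<lambda>i. x $ i"] by simp
    also have "(\<Sum>i\<in>?B. x $ i) = - c * N"
      by (simp add: N_def xB sum_distrib_left sum_negf)
    also have "(\<Sum>i\<in>-?B. x $ i) = P" by (simp add: P_def xnB)
    finally show ?thesis using N by (simp add: c_def)
  qed
  let ?S = "\<lambda>v u. \<Sum>i\<in>branch E u v. x $ i"
  \<comment> \<open>Every edge points away from the root in exactly one direction; there the subtree sum and the
    increment of \<open>x\<close> share the sign that \<open>x\<close> has on the branch.\<close>
  have outward: "0 < ?S v u / (x $ v - x $ u)" if e: "{v, u} \<in> E" and r: "r \<in> branch E v u" for v u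
  proof -
    have e': "{u, v} \<in> E" using e by (simp add: insert_commute)
    have uv: "u \<noteq> v" using T e tree_edge_neq by blast
    have rv: "v \<noteq> r" using r centre_notin_branch[OF uv] by auto
    have nr: "r \<notin> branch E u v" using tree_edge_sides_disjoint[OF T e' r] .
    note sub = subtree_subset_branch[OF T e r]
    note dl = depth_increases[OF T e r]
    show ?thesis
    proof (cases "v \<in> ?B")
      case True
      with sub branch_eq[OF True] have "branch E u v \<subseteq> ?B" by simp
      then have "0 < (\<Sum>i\<in>branch E u v. - x $ i)"
        using neg branch_refl[of v E u] by (intro sum_pos) auto
      then have "?S v u < 0" by (simp add: sum_negf)
      moreover have "x $ v < x $ u"
      proof (cases "u = r")
        case True
        then show ?thesis using neg[OF \<open>v \<in> ?B\<close>] xr s by simp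
      next
        case False
        then have "u \<in> ?B" using branch_step[OF \<open>v \<in> ?B\<close> e rv] by simp
        with \<open>v \<in> ?B\<close> dl c show ?thesis by (simp add: xB)
      qed
      ultimately show ?thesis by (simp add: divide_neg_neg)
    next
      case False
      have "i \<notin> ?B" if "i \<in> branch E u v" for i
        using False that sub branch_eq[of i E r v] branch_eq[of i E r b] branch_refl[of v E r] by blast
      then have "0 < ?S v u"
        using pos branch_refl[of v E u] nr by (intro sum_pos) auto
      moreover have "u \<notin> ?B" using branch_step[of u E r b v] e' rv rB False by metis
      then have "x $ u < x $ v" using False dl by (simp add: xnB)
      ultimately show ?thesis by simp
    qed
  qed
  have "0 < ?S v u / (x $ v - x $ u)" if e: "{v, u} \<in> E" for v u
  proof -
    have e': "{u, v} \<in> E" using e by (simp add: insert_commute)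
    from tree_edge_sides_cover[OF T e, of r] show ?thesis
    proof
      assume "r \<in> branch E u v"
      note outward[OF e' this]
      moreover have "?S u v = - ?S v u"
        using sum_over_edge_sides[OF T e, of "\<lambda>i. x $ i"] tot by simp
      ultimately have "0 < - ?S v u / (x $ u - x $ v)" by metis
      then show ?thesis by (metis minus_diff_eq minus_divide_divide)
    qed (rule outward[OF e])
  qed
  from tree_weights_for_eigenvector[OF T tot this] obtain w
    where "weight_assignment E w" "weighted_laplacian E w *v x = x" by blast
  with xr neg pos show ?thesis by (intro exI[of _ x] exI[of _ w]) auto
qed

section \<open>Spectral gap from a sign-changing eigenvector\<close>

lemma laplacian_bilinear:
  "z \<bullet> (weighted_laplacian E w *v y) =
   (\<Sum>i\<in>UNIV. \<Sum>j\<in>UNIV. adj_weight E w i j * ((z $ i - z $ j) * (y $ i - y $ j))) / 2"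
proof -
  let ?t = "\<lambda>i j. adj_weight E w i j * (z $ i * (y $ i - y $ j))"
  have 1: "z \<bullet> (weighted_laplacian E w *v y) = (\<Sum>i\<in>UNIV. \<Sum>j\<in>UNIV. ?t i j)"
    by (simp add: inner_vec_def weighted_laplacian_apply sum_distrib_left algebra_simps)
  have 2: "(\<Sum>i\<in>UNIV. \<Sum>j\<in>UNIV. ?t i j) = (\<Sum>i\<in>UNIV. \<Sum>j\<in>UNIV. ?t j i)"
    by (rule sum.swap)
  have "(\<Sum>i\<in>UNIV. \<Sum>j\<in>UNIV. adj_weight E w i j * ((z $ i - z $ j) * (y $ i - y $ j)))
      = (\<Sum>i\<in>UNIV. \<Sum>j\<in>UNIV. ?t i j + ?t j i)"
    by (intro sum.cong refl) (simp add: adj_weight_commute[of E w j i for i j] algebra_simps)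
  also have "\<dots> = 2 * (z \<bullet> (weighted_laplacian E w *v y))"
    unfolding sum.distrib using 1 2 by simp
  finally show ?thesis by simp
qed

text \<open>
  Substituting \<open>z = f x\<close> for an eigenvector \<open>x\<close>, edge by edge via
  \<open>(f\<^sub>i x\<^sub>i - f\<^sub>j x\<^sub>j)\<^sup>2 = (x\<^sub>i - x\<^sub>j) (f\<^sub>i\<^sup>2 x\<^sub>i - f\<^sub>j\<^sup>2 x\<^sub>j) + x\<^sub>i x\<^sub>j (f\<^sub>i - f\<^sub>j)\<^sup>2\<close>,
  splits the quadratic form into the part \<open>(f\<^sup>2 x) \<bullet> L x = z \<bullet> z\<close> and a form in the differences of \<open>f\<close>
  that is nonnegative as long as \<open>f\<close> does not vary across sign changes of \<open>x\<close>.
\<close>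

lemma ground_state_identity:
  fixes x z :: "real ^ 'n::finite"
  assumes "weighted_laplacian E w *v x = x" and z: "\<And>i. z $ i = f i * x $ i"
  shows "z \<bullet> (weighted_laplacian E w *v z) = z \<bullet> z +
    (\<Sum>i\<in>UNIV. \<Sum>j\<in>UNIV. adj_weight E w i j * (x $ i * x $ j * (f i - f j)\<^sup>2)) / 2"
proof -
  define u :: "real ^ 'n" where "u = (\<chi> i. (f i)\<^sup>2 * x $ i)"
  have "z \<bullet> z = u \<bullet> (weighted_laplacian E w *v x)"
    unfolding assms(1) by (simp add: inner_vec_def u_def z power2_eq_square algebra_simps)
  moreover have "(\<Sum>i\<in>UNIV. \<Sum>j\<in>UNIV. adj_weight E w i j * ((z $ i - z $ j) * (z $ i - z $ j))) =
      (\<Sum>i\<in>UNIV. \<Sum>j\<in>UNIV. adj_weight E w i j * ((u $ i - u $ j) * (x $ i - x $ j))) +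
      (\<Sum>i\<in>UNIV. \<Sum>j\<in>UNIV. adj_weight E w i j * (x $ i * x $ j * (f i - f j)\<^sup>2))"
    unfolding sum.distrib[symmetric]
    by (intro sum.cong refl) (simp add: u_def z power2_eq_square algebra_simps)
  ultimately show ?thesis
    unfolding laplacian_bilinear by simp
qed

lemma eigenvector_sum_zero:
  assumes "weighted_laplacian E w *v y = m *\<^sub>R y" "m \<noteq> 0"
  shows "(\<Sum>i\<in>UNIV. y $ i) = 0"
proof -
  have "(\<chi> i. 1) \<bullet> (weighted_laplacian E w *v y) = 0"
    unfolding laplacian_bilinear by simp
  with assms show ?thesis by (simp add: inner_vec_def sum_distrib_left[symmetric])
qed

lemma laplacian_kernel_constant:
  assumes T: "tree E" and w: "weight_assignment E w" and y: "weighted_laplacian E w *v y = 0"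
  shows "y $ i = y $ j"
proof -
  have nn: "0 \<le> adj_weight E w i j * ((y $ i - y $ j) * (y $ i - y $ j))" for i j
    using adj_weight_nonneg[OF w, of i j] by simp
  have "y \<bullet> (weighted_laplacian E w *v y) = 0" using y by simp
  then have 0: "adj_weight E w i j * ((y $ i - y $ j) * (y $ i - y $ j)) = 0" for i j
    unfolding laplacian_bilinear using nn
    by (simp add: sum_nonneg_eq_0_iff sum_nonneg)
  have "y $ i = y $ j" if "{i, j} \<in> E" for i j
    using 0[of i j] adj_weight_pos[OF w that] by simp
  with T show ?thesis by (intro tree_induct[of E "\<lambda>j. y $ i = y $ j" i j]) auto
qed

text \<open>
  Shifting \<open>y\<close> by a constant leaves the quadratic form unchanged and can only increase the norm,
  because \<open>y\<close> is orthogonal to the constant vectors. Hence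
  \<open>m |y|\<^sup>2 = |y|\<^sup>2 + n c\<^sup>2 + \<close> (a nonnegative form in the differences of \<open>f\<close>), where \<open>n\<close> is the number of
  vertices. All three conclusions are read off from this equation.
\<close>

lemma spectral_gap:
  fixes x y :: "real ^ 'n::finite"
  assumes w: "weight_assignment E w" and x: "weighted_laplacian E w *v x = x"
    and y: "weighted_laplacian E w *v y = m *\<^sub>R y" "y \<noteq> 0" "m \<noteq> 0"
    and f: "\<And>i. y $ i - c = f i * x $ i"
    and edge: "\<And>i j. {i, j} \<in> E \<Longrightarrow> 0 \<le> x $ i * x $ j \<or> f i = f j"
  shows "1 \<le> m"
    and "m = 1 \<Longrightarrow> c = 0"
    and "m = 1 \<Longrightarrow> {i, j} \<in> E \<Longrightarrow> x $ i * x $ j * (f i - f j)\<^sup>2 = 0"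
proof -
  define z :: "real ^ 'n" where "z = (\<chi> i. y $ i - c)"
  define D where "D = (\<Sum>i\<in>UNIV. \<Sum>j\<in>UNIV. adj_weight E w i j * (x $ i * x $ j * (f i - f j)\<^sup>2))"
  have nn: "0 \<le> adj_weight E w i j * (x $ i * x $ j * (f i - f j)\<^sup>2)" for i j
  proof (cases "{i, j} \<in> E")
    case True
    from edge[OF this] have "0 \<le> x $ i * x $ j * (f i - f j)\<^sup>2" by auto
    with adj_weight_nonneg[OF w] show ?thesis by (rule mult_nonneg_nonneg)
  qed (simp add: adj_weight_def)
  have D: "0 \<le> D" unfolding D_def by (intro sum_nonneg nn)
  have "z \<bullet> (weighted_laplacian E w *v z) = z \<bullet> z + D / 2"
    unfolding D_def using ground_state_identity[OF x, of z f] f by (simp add: z_def)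
  moreover have "z \<bullet> (weighted_laplacian E w *v z) = y \<bullet> (weighted_laplacian E w *v y)"
    unfolding laplacian_bilinear by (simp add: z_def)
  moreover have "z \<bullet> z = y \<bullet> y + real CARD('n) * c\<^sup>2"
  proof -
    have "z \<bullet> z = (\<Sum>i\<in>UNIV. y $ i * y $ i - 2 * c * y $ i + c\<^sup>2)"
      unfolding inner_vec_def by (rule sum.cong) (auto simp: z_def power2_eq_square algebra_simps)
    also have "\<dots> = y \<bullet> y - 2 * c * (\<Sum>i\<in>UNIV. y $ i) + real CARD('n) * c\<^sup>2"
      by (simp add: inner_vec_def sum.distrib sum_subtractf sum_distrib_left)
    finally show ?thesis using eigenvector_sum_zero[OF y(1,3)] by simp
  qed
  ultimately have key: "m * (y \<bullet> y) = y \<bullet> y + real CARD('n) * c\<^sup>2 + D / 2"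
    using y(1) by simp
  have yy: "0 < y \<bullet> y" using y(2) by simp
  have cc: "0 \<le> real CARD('n) * c\<^sup>2" by simp
  have "1 * (y \<bullet> y) \<le> m * (y \<bullet> y)" using key D cc by linarith
  then show "1 \<le> m" using yy by simp
  { assume "m = 1"
    with key have "real CARD('n) * c\<^sup>2 + D / 2 = 0" by simp
    with D cc have 0: "real CARD('n) * c\<^sup>2 = 0" "D = 0" by linarith+
    then show "c = 0" by simp
    assume e: "{i, j} \<in> E"
    have "adj_weight E w i j * (x $ i * x $ j * (f i - f j)\<^sup>2) = 0"
      using 0(2) nn unfolding D_def by (simp add: sum_nonneg_eq_0_iff sum_nonneg)
    moreover have "adj_weight E w i j \<noteq> 0" using adj_weight_pos[OF w e] by simp
    ultimately show "x $ i * x $ j * (f i - f j)\<^sup>2 = 0" by simp }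
qed

section \<open>The second smallest root of the characteristic polynomial\<close>

lemma poly_det: "poly (det A) a = det (\<chi> i j. poly (A $ i $ j) a)"
  for A :: "real poly ^ 'n::finite ^ 'n"
  by (simp add: det_def poly_sum poly_prod)

lemma poly_charpoly_eq_0_iff:
  fixes A :: "real ^ 'n::finite ^ 'n"
  shows "poly (charpoly A) a = 0 \<longleftrightarrow> (\<exists>v. eigenvector A a v)"
proof -
  have "poly (charpoly A) a = det (a *\<^sub>R mat 1 - A)"
    unfolding charpoly_def poly_det
    by (rule arg_cong[of _ _ det]) (auto simp: vec_eq_iff mat_def)
  also have "\<dots> = 0 \<longleftrightarrow> \<not> (\<forall>v. (a *\<^sub>R mat 1 - A) *v v = 0 \<longrightarrow> v = 0)"
    by (metis invertible_det_nz invertible_left_inverse matrix_left_invertible_ker)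
  also have "\<dots> \<longleftrightarrow> (\<exists>v. eigenvector A a v)"
  proof -
    have "(a *\<^sub>R mat 1 - A) *v v = 0 \<longleftrightarrow> A *v v = a *\<^sub>R v" for v
      by (auto simp: matrix_vector_mult_diff_rdistrib scaleR_matrix_vector_assoc[symmetric])
    then show ?thesis by (auto simp: eigenvector_def)
  qed
  finally show ?thesis .
qed

text \<open>
  Adding all columns of \<open>X I - A\<close> to the column \<open>r\<close> turns that column into the constant \<open>X\<close>, since the
  rows of \<open>A\<close> sum to zero. This exhibits one factor \<open>X\<close>; the cofactor at 0 is the determinant of \<open>- A\<close>
  with its column \<open>r\<close> replaced by ones. That matrix is injective: for a vector \<open>v\<close> in its kernel, the
  vanishing column sums of \<open>A\<close> give \<open>v r = 0\<close>, and then \<open>v\<close> is in the kernel of \<open>A\<close>, hence constant,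
  hence zero.
\<close>

lemma charpoly_zero_simple_root:
  fixes A :: "real ^ 'n::finite ^ 'n"
  assumes rows: "\<And>i. (\<Sum>j\<in>UNIV. A $ i $ j) = 0" and cols: "\<And>j. (\<Sum>i\<in>UNIV. A $ i $ j) = 0"
    and ker: "\<And>y i j. A *v y = 0 \<Longrightarrow> y $ i = y $ j"
  shows "charpoly A \<noteq> 0" "order 0 (charpoly A) = 1"
proof -
  fix r :: 'n
  define C :: "real poly ^ 'n ^ 'n" where "C = mat [:0, 1:] - (\<chi> i j. [:A $ i $ j:])"
  \<comment> \<open>\<open>S\<close> performs the column operation, \<open>D\<close> carries the extracted factor, \<open>M\<close> is the cofactor matrix.\<close>
  define S :: "real poly ^ 'n ^ 'n" where "S = (\<chi> i j. if j = r \<or> i = j then 1 else 0)"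
  define M :: "real poly ^ 'n ^ 'n" where "M = (\<chi> i j. if j = r then 1 else C $ i $ j)"
  define D :: "real poly ^ 'n ^ 'n" where "D = (\<chi> i j. if i = j then if j = r then [:0, 1:] else 1 else 0)"
  have "C ** S = M ** D"
  proof -
    have MD: "(\<Sum>k\<in>UNIV. M $ i $ k * D $ k $ j) = M $ i $ j * (if j = r then [:0, 1:] else 1)" for i j
    proof -
      have "(\<Sum>k\<in>UNIV. M $ i $ k * D $ k $ j) =
          (\<Sum>k\<in>UNIV. if k = j then M $ i $ j * (if j = r then [:0, 1:] else 1) else 0)"
        by (intro sum.cong) (auto simp: D_def)
      then show ?thesis by simp
    qed
    have "(\<Sum>k\<in>UNIV. C $ i $ k * S $ k $ j) = (\<Sum>k\<in>UNIV. M $ i $ k * D $ k $ j)" for i j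
    proof (cases "j = r")
      case True
      have "(\<Sum>k\<in>UNIV. C $ i $ k) = (\<Sum>k\<in>UNIV. if i = k then [:0, 1:] else 0) - (\<Sum>k\<in>UNIV. [:A $ i $ k:])"
        by (simp add: C_def mat_def sum_subtractf)
      also have "(\<Sum>k\<in>UNIV. [:A $ i $ k:]) = [:\<Sum>k\<in>UNIV. A $ i $ k:]"
        by (rule poly_eqI) (simp add: coeff_sum coeff_pCons split: nat.split)
      finally have "(\<Sum>k\<in>UNIV. C $ i $ k) = [:0, 1:]" using rows by simp
      with True show ?thesis unfolding MD by (simp add: S_def M_def)
    next
      case False
      then have "(\<Sum>k\<in>UNIV. C $ i $ k * S $ k $ j) = (\<Sum>k\<in>UNIV. if k = j then C $ i $ j else 0)"
        by (intro sum.cong) (auto simp: S_def)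
      with False show ?thesis unfolding MD by (simp add: M_def)
    qed
    then show ?thesis by (simp add: matrix_matrix_mult_def vec_eq_iff)
  qed
  then have "det C * det S = det M * det D" by (metis det_mul)
  moreover have "det D = [:0, 1:]"
  proof -
    have "det D = (\<Prod>i\<in>UNIV. if i = r then [:0, 1:] else 1)"
      by (subst det_diagonal) (auto simp: D_def)
    then show ?thesis by simp
  qed
  ultimately have fact: "charpoly A * det S = det M * [:0, 1:]"
    by (simp add: charpoly_def C_def)
  have "poly (det M) 0 \<noteq> 0"
  proof -
    define N :: "real ^ 'n ^ 'n" where "N = (\<chi> i j. if j = r then 1 else - A $ i $ j)"
    have "v = 0" if Nv: "N *v v = 0" for v
    proof -
      define v' where "v' = (\<chi> i. if i = r then 0 else v $ i)"
      have "(N *v v) $ i = v $ r - (A *v v') $ i" for i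
      proof -
        have "(N *v v) $ i = (\<Sum>j\<in>UNIV. (if j = r then v $ r else 0) - A $ i $ j * v' $ j)"
          unfolding matrix_vector_mult_def
          by (auto simp: N_def v'_def intro!: sum.cong)
        then show ?thesis by (simp add: sum_subtractf matrix_vector_mult_def)
      qed
      with Nv have Av: "(A *v v') $ i = v $ r" for i by (simp add: vec_eq_iff)
      have "(\<Sum>i\<in>UNIV. (A *v v') $ i) = (\<Sum>j\<in>UNIV. (\<Sum>i\<in>UNIV. A $ i $ j) * v' $ j)"
        unfolding matrix_vector_mult_def by (simp add: sum_distrib_right, rule sum.swap)
      then have vr: "v $ r = 0" using cols Av by simp
      with Av have "A *v v' = 0" by (simp add: vec_eq_iff)
      from ker[OF this, of _ r] have v'0: "v' $ i = 0" for i by (simp add: v'_def)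
      have "v $ i = 0" for i using v'0[of i] vr by (cases "i = r") (simp_all add: v'_def)
      then show ?thesis by (simp add: vec_eq_iff)
    qed
    then have "det N \<noteq> 0"
      by (metis invertible_det_nz invertible_left_inverse matrix_left_invertible_ker)
    moreover have "poly (det M) 0 = det N"
      unfolding poly_det
      by (rule arg_cong[of _ _ det]) (auto simp: vec_eq_iff M_def N_def C_def mat_def)
    ultimately show ?thesis by simp
  qed
  then have M0: "det M \<noteq> 0" "order 0 (det M) = 0" by (auto simp: order_0I)
  with fact have nz: "charpoly A * det S \<noteq> 0" by auto
  then show c0: "charpoly A \<noteq> 0" by auto
  have "order 0 (charpoly A * det S) = order 0 (det M) + order 0 [:0, 1 :: real:]"
    unfolding fact using M0(1) by (intro order_mult) auto
  also have "order 0 [:0, 1 :: real:] = 1" using order_power_n_n[of "0::real" 1] by simp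
  finally have "order 0 (charpoly A) \<le> 1" using M0 nz by (simp add: order_mult)
  moreover have "eigenvector A 0 (\<chi> i. 1)"
    using rows by (simp add: eigenvector_def matrix_vector_mult_def vec_eq_iff)
  then have "order 0 (charpoly A) \<noteq> 0"
    using poly_charpoly_eq_0_iff[of A 0] c0 by (auto simp: order_root)
  ultimately show "order 0 (charpoly A) = 1" by simp
qed

lemma second_smallest_eigenvalueI:
  fixes A :: "real ^ 'n::finite ^ 'n"
  assumes p: "charpoly A \<noteq> 0" "order 0 (charpoly A) = 1"
    and l: "eigenvector A l v" "0 < l"
    and gap: "\<And>m y. eigenvector A m y \<Longrightarrow> m \<noteq> 0 \<Longrightarrow> l \<le> m"
  shows "second_smallest_eigenvalue A = l"
proof -
  let ?M = "proots (charpoly A)"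
  have cnt: "count ?M 0 = 1" using p by simp
  have ge: "l \<le> m" if "m \<in># ?M" "m \<noteq> 0" for m
    using that p(1) gap poly_charpoly_eq_0_iff[of A m] by auto
  have "l \<in># ?M" using p(1) l poly_charpoly_eq_0_iff[of A l] by auto
  then obtain N' where N': "?M = add_mset l N'" by (meson multi_member_split)
  have "0 \<in># N'" using cnt l(2) unfolding N' by (metis count_add_mset count_eq_zero_iff order_less_irrefl zero_neq_one)
  then obtain N where N: "N' = add_mset 0 N" by (meson multi_member_split)
  have "0 \<notin># N" using cnt l(2) unfolding N' N by (auto simp: count_eq_zero_iff)
  then have N_ge: "l \<le> m" if "m \<in># N" for m
    using ge[of m] that unfolding N' N by auto
  have "insort l (sorted_list_of_multiset N) = l # sorted_list_of_multiset N"
    using N_ge by (intro insort_is_Cons) simp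
  moreover have "insort 0 (l # sorted_list_of_multiset N) = 0 # l # sorted_list_of_multiset N"
    using l(2) by simp
  moreover have "?M = add_mset 0 (add_mset l N)" unfolding N' N by simp
  ultimately show ?thesis by (simp add: second_smallest_eigenvalue_def)
qed

lemma laplacian_second_eigenvalue:
  fixes E :: "'n::finite set set"
  assumes T: "tree E" and w: "weight_assignment E w"
    and x: "eigenvector (weighted_laplacian E w) 1 x"
    and gap: "\<And>m y. eigenvector (weighted_laplacian E w) m y \<Longrightarrow> m \<noteq> 0 \<Longrightarrow> 1 \<le> m"
  shows "second_smallest_eigenvalue (weighted_laplacian E w) = 1"
proof -
  have "weighted_laplacian E w $ i $ j = weighted_laplacian E w $ j $ i" for i j
    by (simp add: weighted_laplacian_def insert_commute)
  then have "(\<Sum>i\<in>UNIV. weighted_laplacian E w $ i $ j) = 0" for j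
    using weighted_laplacian_row_sum[of E w j] by simp
  from charpoly_zero_simple_root[OF weighted_laplacian_row_sum this
      laplacian_kernel_constant[OF T w]]
  show ?thesis by (rule second_smallest_eigenvalueI[OF _ _ x]) (use gap in auto)
qed

section \<open>The two types of characteristic sets\<close>

text \<open>
  The interface to the spectral part. The premise \<open>split\<close> asks for the constant that makes an arbitrary
  vector vanish where \<open>x\<close> changes sign; the premise \<open>char\<close> only concerns vectors of the form that the
  equality case of the spectral gap leaves over.
\<close>

lemma characteristic_setI:
  fixes E :: "'n::finite set set"
  assumes T: "tree E" and w: "weight_assignment E w"
    and x: "weighted_laplacian E w *v x = x" "x \<noteq> 0"
    and split: "\<And>y. \<exists>c f. (\<forall>i. y $ i - c = f i * x $ i) \<and>
      (\<forall>i j. {i, j} \<in> E \<longrightarrow> 0 \<le> x $ i * x $ j \<or> f i = f j)"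
    and char: "\<And>y f. y \<noteq> 0 \<Longrightarrow> \<forall>i. y $ i = f i * x $ i \<Longrightarrow>
      \<forall>i j. {i, j} \<in> E \<and> x $ i * x $ j \<noteq> 0 \<longrightarrow> f i = f j \<Longrightarrow>
      characteristic_set_of_vector E y R"
  shows "characteristic_set E w R"
proof -
  let ?L = "weighted_laplacian E w"
  have ev: "eigenvector ?L 1 x" using x by (simp add: eigenvector_def)
  have "1 \<le> m" if "eigenvector ?L m y" "m \<noteq> 0" for m y
    using split[of y] spectral_gap(1)[OF w x(1)] that unfolding eigenvector_def by metis
  from laplacian_second_eigenvalue[OF T w ev this]
  have F: "fiedler_vector E w y \<longleftrightarrow> eigenvector ?L 1 y" for y
    by (simp add: fiedler_vector_def Let_def)
  have "characteristic_set_of_vector E y R" if "eigenvector ?L 1 y" for y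
  proof -
    from that have y: "?L *v y = 1 *\<^sub>R y" "y \<noteq> 0" by (auto simp: eigenvector_def)
    obtain c f where cf: "\<And>i. y $ i - c = f i * x $ i"
      "\<And>i j. {i, j} \<in> E \<Longrightarrow> 0 \<le> x $ i * x $ j \<or> f i = f j"
      using split[of y] by blast
    note gap = spectral_gap[OF w x(1) y _ cf]
    show ?thesis
    proof (rule char[OF y(2), of f])
      show "\<forall>i. y $ i = f i * x $ i" using cf(1) gap(2) by simp
      show "\<forall>i j. {i, j} \<in> E \<and> x $ i * x $ j \<noteq> 0 \<longrightarrow> f i = f j" using gap(3) by fastforce
    qed
  qed
  with F ev show ?thesis by (auto simp: characteristic_set_def)
qed

text \<open>
  With \<open>x r = 0\<close> the sign change happens at a vertex, and the eigenspace consists of the vectors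
  obtained by scaling \<open>x\<close> independently on the branches at \<open>r\<close> and balancing the total. Such a vector is zero
  at \<open>r\<close> and on each branch either identically zero or nowhere zero, so \<open>r\<close> is the only zero next to
  a nonzero entry.
\<close>

lemma vertex_characteristic_set:
  fixes E :: "'n::finite set set"
  assumes T: "tree E" and ab: "{r, a} \<in> E" "{r, b} \<in> E" "a \<noteq> b"
  shows "\<exists>w. weight_assignment E w \<and> characteristic_set E w {r}"
proof -
  let ?B = "branch E r b"
  have nl: "\<exists>a. {r, a} \<in> E \<and> a \<noteq> b" using ab by blast
  obtain x w where w: "weight_assignment E w" and x: "weighted_laplacian E w *v x = x"
    and xr: "x $ r = 0" and neg': "\<forall>i\<in>?B. x $ i < 0" and pos': "\<forall>i\<in>-?B - {r}. 0 < x $ i"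
    using tree_eigenvector_with_sign_change[OF T ab(2) order_refl nl] by blast
  have neg: "x $ i < 0" if "i \<in> ?B" for i using neg' that by blast
  have pos: "0 < x $ i" if "i \<notin> ?B" "i \<noteq> r" for i using pos' that by blast
  have nz: "x $ i \<noteq> 0" if "i \<noteq> r" for i using neg[of i] pos[of i] that by fastforce
  have x0: "x \<noteq> 0" using neg[OF branch_refl] by auto
  have sgn: "0 \<le> x $ i * x $ j" if e: "{i, j} \<in> E" for i j
  proof (cases "i = r \<or> j = r")
    case True then show ?thesis using xr by auto
  next
    case False
    have "i \<in> ?B \<longleftrightarrow> j \<in> ?B" using branch_step[of i E r b j] branch_step[of j E r b i] e False
      by (auto simp: insert_commute)
    then show ?thesis using neg pos False by (metis less_imp_le mult_nonneg_nonneg mult_nonpos_nonpos)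
  qed
  have "characteristic_set E w {r}"
  proof (rule characteristic_setI[OF T w x x0])
    fix y :: "real ^ 'n"
    \<comment> \<open>At \<open>r\<close> the quotient is a division by zero; both sides of the required equation are zero there.\<close>
    show "\<exists>c f. (\<forall>i. y $ i - c = f i * x $ i) \<and>
      (\<forall>i j. {i, j} \<in> E \<longrightarrow> 0 \<le> x $ i * x $ j \<or> f i = f j)"
      using sgn nz xr
      by (intro exI[of _ "y $ r"] exI[of _ "\<lambda>i. (y $ i - y $ r) / x $ i"]) (auto, metis)
  next
    fix y :: "real ^ 'n" and f
    assume y0: "y \<noteq> 0" and "\<forall>i. y $ i = f i * x $ i"
      and "\<forall>i j. {i, j} \<in> E \<and> x $ i * x $ j \<noteq> 0 \<longrightarrow> f i = f j"
    then have y: "\<And>i. y $ i = f i * x $ i"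
      and f: "\<And>i j. {i, j} \<in> E \<Longrightarrow> i \<noteq> r \<Longrightarrow> j \<noteq> r \<Longrightarrow> f i = f j"
      using nz by auto
    have yr: "y $ r = 0" using y xr by simp
    from y0 obtain v where v: "y $ v \<noteq> 0" by (auto simp: vec_eq_iff)
    with yr have vr: "v \<noteq> r" by auto
    obtain u where u: "{r, u} \<in> E" "v \<in> branch E r u" using tree_in_some_branch[OF T vr] .
    from u(2) have "f v = f u"
      by (induction rule: branch_induct) (auto dest: f)
    with v y have "f u \<noteq> 0" by auto
    with u(1) nz[of u] y tree_edge_neq[OF T] have yu: "y $ u \<noteq> 0" by auto
    have only: "k = r" if "y $ k = 0" "{k, j} \<in> E" "y $ j \<noteq> 0" for k j
    proof (rule ccontr)
      assume k: "k \<noteq> r"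
      have "j \<noteq> r" using yr that by auto
      with f[OF that(2) k] have "f k = f j" by simp
      moreover have "f k = 0" using that(1) y nz[OF k] by simp
      ultimately show False using that(3) y by simp
    qed
    have "{k. y $ k = 0 \<and> (\<exists>j. {k, j} \<in> E \<and> y $ j \<noteq> 0)} = {r}"
      using yr u(1) yu only by blast
    with yr show "characteristic_set_of_vector E y {r}"
      by (auto simp: characteristic_set_of_vector_def)
  qed
  with w show ?thesis by blast
qed

text \<open>
  With \<open>x p = 1\<close> the vector \<open>x\<close> has no zero entry and \<open>{p, q}\<close> is the only edge across which it changes
  sign. The factor \<open>f\<close> is constant along all edges, so every Fiedler vector is a multiple of \<open>x\<close>.
\<close>

lemma edge_characteristic_set:
  fixes E :: "'n::finite set set"
  assumes T: "tree E" and e0: "{p, q} \<in> E"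
  shows "\<exists>w. weight_assignment E w \<and> characteristic_set E w {p, q}"
proof -
  let ?B = "branch E p q"
  have pq: "p \<noteq> q" using T e0 tree_edge_neq by blast
  obtain x w where w: "weight_assignment E w" and x: "weighted_laplacian E w *v x = x"
    and xp: "x $ p = 1" and neg': "\<forall>i\<in>?B. x $ i < 0" and pos': "\<forall>i\<in>-?B - {p}. 0 < x $ i"
    using tree_eigenvector_with_sign_change[OF T e0, of 1] by auto
  have neg: "x $ i < 0" if "i \<in> ?B" for i using neg' that by blast
  have pos: "0 < x $ i" if "i \<notin> ?B" for i using pos' that xp by (cases "i = p") auto
  have nz: "x $ i \<noteq> 0" for i using neg[of i] pos[of i] by fastforce
  have xq: "x $ q < 0" using neg[OF branch_refl] .
  have cross: "i = p \<and> j = q" if e: "{i, j} \<in> E" and "i \<notin> ?B" "j \<in> ?B" for i j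
  proof -
    have jp: "j \<noteq> p" using that(3) centre_notin_branch[of q p E] pq by auto
    have "i = p" using branch_step[of j E p q i] that jp by (auto simp: insert_commute)
    with tree_neighbours_in_distinct_branches[OF T e0, of j] that show ?thesis by auto
  qed
  have sgn: "0 \<le> x $ i * x $ j \<or> {i, j} = {p, q}" if e: "{i, j} \<in> E" for i j
  proof (cases "i \<in> ?B"; cases "j \<in> ?B")
    assume "i \<in> ?B" "j \<in> ?B"
    then show ?thesis using neg[of i] neg[of j] by (simp add: mult_nonpos_nonpos)
  next
    assume "i \<notin> ?B" "j \<notin> ?B"
    then show ?thesis using pos[of i] pos[of j] by simp
  next
    assume "i \<in> ?B" "j \<notin> ?B"
    then show ?thesis using cross[of j i] e by (auto simp: insert_commute)
  next
    assume "i \<notin> ?B" "j \<in> ?B"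
    then show ?thesis using cross[of i j] e by auto
  qed
  have "characteristic_set E w {p, q}"
  proof (rule characteristic_setI[OF T w x])
    show "x \<noteq> 0" using xp by auto
  next
    fix y :: "real ^ 'n"
    \<comment> \<open>The value of \<open>y\<close>, interpolated linearly along the edge, at the point where the interpolation of \<open>x\<close>
      vanishes; for this constant the quotient \<open>f\<close> agrees at both ends of the edge.\<close>
    define c where "c = (y $ q - x $ q * y $ p) / (1 - x $ q)"
    define f where "f i = (y $ i - c) / x $ i" for i
    have "f p = f q"
    proof -
      have "c * (1 - x $ q) = y $ q - x $ q * y $ p" using xq by (simp add: c_def)
      then have "(y $ p - c) * x $ q = y $ q - c" by (simp add: algebra_simps)
      with xq xp show ?thesis by (simp add: f_def field_simps)
    qed
    then have "0 \<le> x $ i * x $ j \<or> f i = f j" if "{i, j} \<in> E" for i j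
      using sgn[OF that] by (auto simp: doubleton_eq_iff)
    then show "\<exists>c f. (\<forall>i. y $ i - c = f i * x $ i) \<and>
      (\<forall>i j. {i, j} \<in> E \<longrightarrow> 0 \<le> x $ i * x $ j \<or> f i = f j)"
      using nz by (intro exI[of _ c] exI[of _ f]) (auto simp: f_def)
  next
    fix y :: "real ^ 'n" and f
    assume y0: "y \<noteq> 0" and y: "\<forall>i. y $ i = f i * x $ i"
      and "\<forall>i j. {i, j} \<in> E \<and> x $ i * x $ j \<noteq> 0 \<longrightarrow> f i = f j"
    then have f: "f i = f j" if "{i, j} \<in> E" for i j using nz that by auto
    have fc: "f i = f p" for i
      using T by (induction i rule: tree_induct[where u = p]) (auto dest: f)
    have yx: "y $ i = f p * x $ i" for i using y fc by metis
    have k: "f p \<noteq> 0" using y0 yx by (auto simp: vec_eq_iff)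
    then have kk: "0 < f p * f p" by (simp add: zero_less_mult_iff) linarith
    have prod: "y $ i * y $ j < 0 \<longleftrightarrow> x $ i * x $ j < 0" for i j
    proof -
      have "y $ i * y $ j = (f p * f p) * (x $ i * x $ j)" by (simp add: yx algebra_simps)
      then show ?thesis using kk by (simp only: mult_less_0_iff) auto
    qed
    have "{e \<in> E. \<exists>k l. e = {k, l} \<and> y $ k * y $ l < 0} = {{p, q}}"
    proof -
      have "x $ p * x $ q < 0" using xp xq by simp
      with e0 have "{p, q} \<in> {e \<in> E. \<exists>k l. e = {k, l} \<and> x $ k * x $ l < 0}" by blast
      moreover have "e = {p, q}" if "e \<in> E" "e = {k, l}" "x $ k * x $ l < 0" for e k l
        using sgn[of k l] that by auto
      ultimately show ?thesis unfolding prod by blast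
    qed
    moreover have "\<nexists>v. y $ v = 0" using yx k nz by auto
    ultimately show "characteristic_set_of_vector E y {p, q}"
      unfolding characteristic_set_of_vector_def by auto
  qed
  with w show ?thesis by blast
qed

lemma non_leaf_two_neighbours:
  fixes E :: "'n::finite set set"
  assumes T: "tree E" and "2 \<le> CARD('n)" and "\<not> leaf E r"
  obtains a b where "{r, a} \<in> E" "{r, b} \<in> E" "a \<noteq> b"
proof -
  have "\<exists>y. y \<noteq> r"
  proof (rule ccontr)
    assume "\<nexists>y. y \<noteq> r"
    then have "(UNIV :: 'n set) = {r}" by auto
    then have "CARD('n) = 1" by (metis card.empty card.insert empty_iff finite.emptyI One_nat_def)
    with assms(2) show False by simp
  qed
  then obtain y where "y \<noteq> r" by blast
  from tree_in_some_branch[OF T this] obtain a where a: "{r, a} \<in> E" by blast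
  have "{e \<in> E. r \<in> e} \<noteq> {{r, a}}"
  proof
    assume "{e \<in> E. r \<in> e} = {{r, a}}"
    then have "card {e \<in> E. r \<in> e} = 1" by simp
    with assms(3) show False by (simp add: leaf_def)
  qed
  with a obtain e where e: "e \<in> E" "r \<in> e" "e \<noteq> {r, a}" by blast
  then have "card e = 2" using T by (auto simp: tree_def simple_graph_def)
  with e(2) obtain b where b: "e = {r, b}" by (auto simp: card_2_iff)
  with e have "{r, b} \<in> E" "a \<noteq> b" by auto
  with a that show ?thesis by blast
qed

theorem corollary2p22:
  fixes E :: "'n::finite set set" and R :: "'n set"
  assumes "tree E"
    and "2 \<le> CARD('n)"
    and "(\<exists>r. \<not> leaf E r \<and> R = {r}) \<or> (\<exists>p q. {p, q} \<in> E \<and> R = {p, q})"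
  shows "\<exists>w. weight_assignment E w \<and> characteristic_set E w R"
  using assms(3)
proof
  assume "\<exists>r. \<not> leaf E r \<and> R = {r}"
  then obtain r where r: "\<not> leaf E r" "R = {r}" by blast
  obtain a b where "{r, a} \<in> E" "{r, b} \<in> E" "a \<noteq> b"
    using non_leaf_two_neighbours[OF assms(1,2) r(1)] .
  with vertex_characteristic_set[OF assms(1)] r(2) show ?thesis by blast
next
  assume "\<exists>p q. {p, q} \<in> E \<and> R = {p, q}"
  with edge_characteristic_set[OF assms(1)] show ?thesis by blast
qed

end
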